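(* Let $\nu\in\mathrm{O}(\Lambda)$ have cycle shape $2^{12}$, with vacuum anomaly $\rho_\nu=3/4$. There is no $h\in\pi_\nu(\Lambda\otimes\mathbb Q)$ such that the set of lattice points $\{\beta\in\pi_\nu(\Lambda):\langle\beta-h,\beta-h\rangle/2=1-\rho_\nu\}$, with edges defined by $\langle\beta_i-\beta_j,\beta_i-\beta_j\rangle/2=2(1-\rho_\nu)$ (no edge), $3(1-\rho_\nu)$ (single edge), $4(1-\rho_\nu)$ (double edge), forms a diagram containing $A_2^3$. In particular, there is no generalised deep hole $g$ of $V_\Lambda$ projecting to $\nu$ with $\Phi(g)=A_2^3$.
   Context: $\Lambda$ is the Leech lattice, $\mathrm O(\Lambda)\cong\mathrm{Co}_0$, $V_\Lambda$ its lattice VOA (strongly rational, i.e.\ rational, $C_2$-cofinite, self-contragredient, CFT-type; holomorphic; central charge 24). $\pi_\nu=\frac1{|\nu|}\sum_i\nu^i$ is the projection onto the $\nu$-fixed subspace of $\Lambda\otimes\mathbb R$. Cycle shape $\prod t^{b_t}$ of $\nu$: characteristic polynomial $\prod(x^t-1)^{b_t}$; vacuum anomaly $\rho_\nu=\frac1{24}\sum b_t(t-1/t)$. Automorphisms of $V_\Lambda$ are $\phi_\eta(\nu)\sigma_h$ ($\phi_\eta(\nu)$ a lift of $\nu$, $\sigma_h=e^{2\pi ih_0}$), projecting to $\nu$. For $g$ of order $n$, $V_\Lambda(g^i)$ is the unique irreducible $g^i$-twisted module; type $0$ means its conformal weight is in $\frac1n\mathbb Z$; positivity: irreducible $V_\Lambda^g$-modules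 other than $V_\Lambda^g$ have positive conformal weight; $V_\Lambda^{\mathrm{orb}(g)}=\bigoplus_{i\in\mathbb Z_n}W^{(i,0)}$ is the cyclic orbifold construction ($W^{(i,0)}$ the $g$-invariants of $V_\Lambda(g^i)$). With $c_n(d)$ given by $\sum_{d\mid n}c_n(d)\gcd(t,d)=n/t$ for all $t\mid n$, $g$ (order $n>1$, type 0, positivity) is a generalised deep hole if $\dim (V_\Lambda^{\mathrm{orb}(g)})_1=24+\sum_{d\mid n}c_n(d)\dim(V_\Lambda^{g^d})_1$ and $\operatorname{rk}(V_\Lambda^{\mathrm{orb}(g)})_1=\operatorname{rk}(V_\Lambda^g)_1$. $\Phi(g)$ is the Dynkin diagram (Cartan matrix $2\langle\alpha_i,\alpha_j\rangle/\langle\alpha_i,\alpha_i\rangle$) of the set of weights of the Cartan subalgebra $(V_\Lambda^g)_1\cong\pi_\nu(\Lambda\otimes\mathbb C)$ of $(V_\Lambda^{\mathrm{orb}(g)})_1$ acting on $V_\Lambda(g)_1$. *)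

theory Defs
  imports "HOL-Analysis.Analysis" "HOL-Computational_Algebra.Polynomial"
begin

definition is_full_lattice :: "(real^24) set \<Rightarrow> bool" where
  "is_full_lattice L \<longleftrightarrow>
     (\<exists>b :: 24 \<Rightarrow> real^24. inj b \<and> independent (range b) \<and>
        L = {x. \<exists>c :: 24 \<Rightarrow> int. x = (\<Sum>i\<in>UNIV. of_int (c i) *\<^sub>R b i)})"

text \<open>The Leech lattice (up to isometry): the even unimodular lattice of rank 24
  without roots (vectors of norm 2).\<close>
definition is_leech_lattice :: "(real^24) set \<Rightarrow> bool" where
  "is_leech_lattice L \<longleftrightarrow>
     is_full_lattice L \<and>
     (\<forall>x\<in>L. \<exists>k::int. x \<bullet> x = 2 * of_int k) \<and>
     L = {y. \<forall>x\<in>L. \<exists>k::int. x \<bullet> y = of_int k} \<and>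
     (\<forall>x\<in>L. x \<bullet> x \<noteq> 2)"

definition lattice_aut :: "(real^24) set \<Rightarrow> (real^24 \<Rightarrow> real^24) \<Rightarrow> bool" where
  "lattice_aut L \<nu> \<longleftrightarrow> orthogonal_transformation \<nu> \<and> \<nu> ` L = L"

definition charpoly :: "real^24^24 \<Rightarrow> real poly" where
  "charpoly A = det (\<chi> i j. (if i = j then [:0, 1:] else 0) - [:A $ i $ j:])"

definition cycle_shape_2_12 :: "(real^24 \<Rightarrow> real^24) \<Rightarrow> bool" where
  "cycle_shape_2_12 \<nu> \<longleftrightarrow> charpoly (matrix \<nu>) = [:-1, 0, 1:] ^ 12"

definition rho_2_12 :: real where
  "rho_2_12 = (1/24) * 12 * (2 - 1/2)"

definition aut_order :: "(real^24 \<Rightarrow> real^24) \<Rightarrow> nat" where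
  "aut_order \<nu> = (LEAST n. n > 0 \<and> \<nu> ^^ n = id)"

definition fix_proj :: "(real^24 \<Rightarrow> real^24) \<Rightarrow> real^24 \<Rightarrow> real^24" where
  "fix_proj \<nu> x = (1 / real (aut_order \<nu>)) *\<^sub>R (\<Sum>i<aut_order \<nu>. (\<nu> ^^ i) x)"

text \<open>L tensor Q, as the rational multiples of lattice vectors.\<close>
definition rat_span :: "(real^24) set \<Rightarrow> (real^24) set" where
  "rat_span L = {of_rat q *\<^sub>R x | q x. x \<in> L}"

definition diag_vertices ::
  "(real^24) set \<Rightarrow> (real^24 \<Rightarrow> real^24) \<Rightarrow> real \<Rightarrow> real^24 \<Rightarrow> (real^24) set" where
  "diag_vertices L \<nu> \<rho> h =
     {\<beta> \<in> fix_proj \<nu> ` L. (\<beta> - h) \<bullet> (\<beta> - h) / 2 = 1 - \<rho>}"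

text \<open>The set forms a diagram: distinct vertices are at half-norm
  2(1-rho) (no edge), 3(1-rho) (single edge) or 4(1-rho) (double edge).\<close>
definition forms_diagram :: "real \<Rightarrow> (real^24) set \<Rightarrow> bool" where
  "forms_diagram \<rho> S \<longleftrightarrow>
     (\<forall>\<beta>\<in>S. \<forall>\<beta>'\<in>S. \<beta> \<noteq> \<beta>' \<longrightarrow>
        (\<beta> - \<beta>') \<bullet> (\<beta> - \<beta>') / 2 \<in> {2 * (1 - \<rho>), 3 * (1 - \<rho>), 4 * (1 - \<rho>)})"

text \<open>The diagram contains A_2^3 (as a full subdiagram): six distinct vertices
  b 0, ..., b 5 with single edges exactly between b(2k) and b(2k+1).\<close>
definition contains_A2_cubed :: "real \<Rightarrow> (real^24) set \<Rightarrow> bool" where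
  "contains_A2_cubed \<rho> S \<longleftrightarrow>
     (\<exists>b :: nat \<Rightarrow> real^24. inj_on b {0..<6} \<and> (\<forall>i<6. b i \<in> S) \<and>
        (\<forall>i<6. \<forall>j<6. i \<noteq> j \<longrightarrow>
           (b i - b j) \<bullet> (b i - b j) / 2 = (if i div 2 = j div 2 then 3 else 2) * (1 - \<rho>)))"

end

theory Submission
  imports Defs
begin

text \<open>
  The characteristic polynomial (x^2 - 1)^12 of nu forces nu^2 to have all eigenvalues 1, hence
  trace 24; an orthogonal map whose trace equals the dimension is the identity, so nu is an
  involution and pi(x) = (x + nu x)/2. Then 2<pi x, pi y> = <x, y> + <x, nu y> is an integer for
  x, y in the lattice, and so is |a - c|^2 + |b - c|^2 - |a - b|^2 for any three vertices a, b, c.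
  Since 1 - rho = 1/4, taking an A_2 edge a, b and a vertex c of another A_2 component gives
  1 + 1 - 3/2 = 1/2, a contradiction whatever the centre h is.
\<close>

lemma det_uminus: "det (- A :: 'a::comm_ring_1^'n^'n) = (-1) ^ CARD('n) * det A"
proof -
  have "- A = (\<chi> i. (-1) *s A $ i)" by (simp add: vec_eq_iff)
  then show ?thesis by (simp add: det_rows_mul)
qed

lemma matrix_diff_rdistrib: "(A - B) ** C = A ** C - B ** (C :: 'a::ring_1^'p^'n)"
  by (vector matrix_matrix_mult_def sum_subtractf algebra_simps)

lemma mat_diff_mult_mat_add:
  fixes A :: "real^'n^'n"
  shows "(mat t - A) ** (mat t + A) = mat (t * t) - A ** A"
proof -
  have mt: "mat t = t *\<^sub>R (mat 1 :: real^'n^'n)" by (vector mat_def)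
  have "mat t ** A = t *\<^sub>R A" "A ** mat t = t *\<^sub>R A"
    unfolding mt by (simp_all add: scalar_matrix_assoc[symmetric] matrix_scalar_ac)
  moreover have "mat t ** mat t = (mat (t * t) :: real^'n^'n)"
    unfolding mt by (simp add: scalar_matrix_assoc[symmetric] matrix_scalar_ac) (vector mat_def)
  ultimately show ?thesis
    by (simp add: matrix_diff_rdistrib matrix_add_ldistrib)
qed

lemma poly_eqI_on_infinite:
  fixes p q :: "'a::idom poly"
  assumes "infinite S" and "\<And>y. y \<in> S \<Longrightarrow> poly p y = poly q y"
  shows "p = q"
proof (rule ccontr)
  assume "p \<noteq> q"
  then have "finite {y. poly (p - q) y = 0}" by (intro poly_roots_finite) simp
  moreover have "S \<subseteq> {y. poly (p - q) y = 0}" using assms(2) by auto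
  ultimately show False using assms(1) finite_subset by blast
qed

lemma coeff_prod_linear_card:
  fixes m :: "'i \<Rightarrow> 'a::idom"
  assumes "finite S"
  shows "coeff (\<Prod>i\<in>S. [:- m i, 1:]) (card S) = 1"
proof -
  have "degree (\<Prod>i\<in>S. [:- m i, 1:]) = card S"
    by (subst degree_prod_eq_sum_degree) auto
  then show ?thesis using lead_coeff_prod[of "\<lambda>i. [:- m i, 1:]" S] by simp
qed

lemma coeff_prod_linear_card_pred:
  fixes m :: "'i \<Rightarrow> 'a::idom"
  assumes "finite S" and "S \<noteq> {}"
  shows "coeff (\<Prod>i\<in>S. [:- m i, 1:]) (card S - 1) = - (\<Sum>i\<in>S. m i)"
  using assms
proof (induction S rule: finite_ne_induct)
  case (singleton a)
  then show ?case by simp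
next
  case (insert a S)
  let ?Q = "\<Prod>i\<in>S. [:- m i, 1:]"
  have "(\<Prod>i\<in>insert a S. [:- m i, 1:]) = smult (- m a) ?Q + pCons 0 ?Q"
    using insert.hyps by simp
  moreover obtain k where k: "card S = Suc k"
    using insert.hyps by (metis card_0_eq not0_implies_Suc)
  ultimately show ?case
    using insert.IH insert.hyps coeff_prod_linear_card[OF insert.hyps(1), of m] by (simp add: k)
qed

definition char_poly :: "'a::comm_ring_1^'n^'n \<Rightarrow> 'a poly" where
  "char_poly A = det (\<chi> i j. (if i = j then [:0, 1:] else 0) - [:A $ i $ j:])"

lemma charpoly_eq_char_poly: "charpoly A = char_poly A"
  unfolding charpoly_def char_poly_def ..

lemma poly_det: "poly (det C) y = det (\<chi> i j. poly (C $ i $ j) y)"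
  for C :: "'a::comm_ring_1 poly^'n^'n"
  unfolding det_def by (simp add: poly_sum poly_prod)

lemma poly_char_poly: "poly (char_poly A) y = det (mat y - A)"
  unfolding char_poly_def poly_det
  by (rule arg_cong[where f = det]) (simp add: vec_eq_iff mat_def)

lemma poly_char_poly_mult_self:
  fixes A :: "real^'n^'n"
  shows "poly (char_poly (A ** A)) (t * t)
           = (-1) ^ CARD('n) * poly (char_poly A) t * poly (char_poly A) (- t)"
proof -
  have "det (mat t + A) = det (- (mat (- t) - A))"
    by (rule arg_cong[where f = det]) (simp add: vec_eq_iff mat_def)
  also have "\<dots> = (-1) ^ CARD('n) * det (mat (- t) - A)"
    by (rule det_uminus)
  finally show ?thesis
    unfolding poly_char_poly mat_diff_mult_mat_add[symmetric] det_mul by simp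
qed

lemma coeff_char_poly_card_pred:
  fixes A :: "'a::idom^'n^'n"
  shows "coeff (char_poly A) (CARD('n) - 1) = - trace A"
proof -
  define C where "C = ((\<chi> i j. (if i = j then [:0, 1:] else 0) - [:A $ i $ j:]) :: 'a poly^'n^'n)"
  define t where "t p = of_int (sign p) * (\<Prod>i\<in>UNIV. C $ i $ p i)" for p
  let ?P = "{p. p permutes (UNIV :: 'n set)}"
  have off_diagonal: "coeff (t p) (CARD('n) - 1) = 0" if p: "p \<in> ?P - {id}" for p
  proof -
    \<comment> \<open>only diagonal entries have degree 1, and p moves at least two indices\<close>
    from p obtain i where pi: "p i \<noteq> i" by (auto simp: fun_eq_iff)
    have "p (p i) \<noteq> p i"
      using pi p permutes_inj[of p UNIV] by (auto dest: injD)
    then have moved: "{i, p i} \<subseteq> {k. p k \<noteq> k}" using pi by auto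
    have "degree (\<Prod>k\<in>UNIV. C $ k $ p k) \<le> (\<Sum>k\<in>UNIV. degree (C $ k $ p k))"
      using degree_prod_sum_le[of UNIV "\<lambda>k. C $ k $ p k"] by (simp add: o_def)
    also have "\<dots> \<le> (\<Sum>k\<in>UNIV. if p k = k then 1 else 0)"
      by (rule sum_mono) (simp add: C_def)
    also have "\<dots> = card (UNIV - {k. p k \<noteq> k})"
      by (simp add: sum.If_cases Collect_neg_eq[symmetric] Compl_eq_Diff_UNIV[symmetric])
    also have "\<dots> \<le> CARD('n) - 2"
      using card_mono[OF finite moved] pi by (simp add: card_Diff_subset)
    finally have "degree (\<Prod>k\<in>UNIV. C $ k $ p k) < CARD('n) - 1"
      using card_mono[OF finite subset_UNIV, of "{i, p i}"] pi by simp
    then show ?thesis by (simp add: t_def of_int_poly coeff_eq_0)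
  qed
  have "coeff (char_poly A) (CARD('n) - 1) = (\<Sum>p\<in>?P. coeff (t p) (CARD('n) - 1))"
    unfolding char_poly_def det_def C_def t_def coeff_sum ..
  also have "\<dots> = coeff (t id) (CARD('n) - 1)"
    using off_diagonal by (simp add: sum.remove[of ?P id] finite_permutations permutes_id)
  also have "t id = (\<Prod>i\<in>UNIV. [:- A $ i $ i, 1:])"
    by (simp add: t_def C_def sign_id)
  finally show ?thesis
    using coeff_prod_linear_card_pred[of UNIV "\<lambda>i. A $ i $ i"] by (simp add: trace_def)
qed

lemma orthogonal_transformation_eq_id_if_trace:
  fixes f :: "real^'n \<Rightarrow> real^'n"
  assumes f: "orthogonal_transformation f" and tr: "trace (matrix f) = CARD('n)"
  shows "f = id"
proof -
  have dist_axis: "norm (f (axis i 1) - axis i 1) ^ 2 = 2 - 2 * matrix f $ i $ i" for i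
  proof -
    define e where "e = (axis i 1 :: real^'n)"
    have "e \<bullet> e = 1" by (simp add: e_def inner_axis_axis)
    moreover have "f e \<bullet> f e = e \<bullet> e"
      using f by (simp add: orthogonal_transformation_def)
    moreover have "matrix f $ i $ i = f e \<bullet> e"
      by (simp add: e_def matrix_def inner_axis)
    ultimately show ?thesis
      unfolding e_def[symmetric] power2_norm_eq_inner
      by (simp add: inner_diff_left inner_diff_right inner_commute)
  qed
  have "(\<Sum>i\<in>UNIV. norm (f (axis i 1) - axis i 1) ^ 2) = 2 * CARD('n) - 2 * trace (matrix f)"
    by (simp add: dist_axis sum_subtractf trace_def sum_distrib_left)
  then have "\<forall>i\<in>UNIV. norm (f (axis i 1) - axis i 1) ^ 2 = 0"
    using tr by (subst sum_nonneg_eq_0_iff[symmetric]) simp_all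
  then have "f b = id b" if "b \<in> Basis" for b
    using that by (auto simp: Basis_vec_def)
  then show ?thesis
    using f linear_id by (intro linear_eq_stdbasis) (auto simp: orthogonal_transformation_def)
qed

lemma cycle_shape_2_12_involution:
  assumes f: "orthogonal_transformation f" and shape: "cycle_shape_2_12 f"
  shows "f \<circ> f = id"
proof -
  define A where "A = matrix f"
  have "poly (char_poly A) t = (t * t - 1) ^ 12" for t
    using shape by (simp add: cycle_shape_2_12_def A_def charpoly_eq_char_poly algebra_simps)
  then have sq: "poly (char_poly (A ** A)) (t * t) = (t * t - 1) ^ 24" for t
    by (simp add: poly_char_poly_mult_self power_add[symmetric])
  have "char_poly (A ** A) = [:-1, 1:] ^ 24"
  proof (rule poly_eqI_on_infinite)
    show "infinite {0::real..1}" by (simp add: infinite_Icc)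
    fix y :: real assume "y \<in> {0..1}"
    then have "y = sqrt y * sqrt y" by simp
    then show "poly (char_poly (A ** A)) y = poly ([:-1, 1:] ^ 24) y"
      using sq[of "sqrt y"] by simp
  qed
  moreover have "(24::nat) choose 23 = 24"
    using binomial_Suc_n[of 23] by simp
  ultimately have "trace (A ** A) = 24"
    using coeff_char_poly_card_pred[of "A ** A"] coeff_linear_poly_power[of 23 24 "-1" "1 :: real"]
    by simp
  moreover have "A ** A = matrix (f \<circ> f)"
    using f by (simp add: A_def matrix_compose orthogonal_transformation_def)
  ultimately show ?thesis
    using f by (intro orthogonal_transformation_eq_id_if_trace) (simp_all add: orthogonal_transformation_compose)
qed

lemma aut_order_involution:
  assumes "f \<circ> f = id"
  shows "aut_order f \<in> {1, 2}" and "f ^^ aut_order f = id"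
proof -
  have two: "(2::nat) > 0 \<and> f ^^ 2 = id" using assms by (simp add: numeral_2_eq_2)
  then have "aut_order f \<le> 2" unfolding aut_order_def by (rule Least_le)
  moreover have "aut_order f > 0 \<and> f ^^ aut_order f = id"
    unfolding aut_order_def by (rule LeastI[of "\<lambda>n. n > 0 \<and> f ^^ n = id", OF two])
  ultimately show "aut_order f \<in> {1, 2}" and "f ^^ aut_order f = id" by auto
qed

lemma fix_proj_involution:
  assumes "f \<circ> f = id"
  shows "fix_proj f x = (1/2) *\<^sub>R (x + f x)"
proof (cases "aut_order f = 1")
  case True
  then have "f = id" using aut_order_involution(2)[OF assms] by simp
  then show ?thesis using True by (simp add: fix_proj_def scaleR_2[symmetric])
next
  case False
  then have "aut_order f = 2" using aut_order_involution(1)[OF assms] by simp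
  then show ?thesis by (simp add: fix_proj_def numeral_2_eq_2)
qed

lemma two_inner_fix_proj_Ints:
  assumes integral: "\<And>x y. x \<in> L \<Longrightarrow> y \<in> L \<Longrightarrow> x \<bullet> y \<in> \<int>"
    and f: "orthogonal_transformation f" "f ` L \<subseteq> L" "f \<circ> f = id"
    and \<beta>: "\<beta> \<in> fix_proj f ` L" "\<beta>' \<in> fix_proj f ` L"
  shows "2 * (\<beta> \<bullet> \<beta>') \<in> \<int>"
proof -
  obtain x y where xy: "x \<in> L" "y \<in> L" and "\<beta> = fix_proj f x" "\<beta>' = fix_proj f y"
    using \<beta> by blast
  have isometry: "f a \<bullet> f b = a \<bullet> b" for a b
    using f(1) by (simp add: orthogonal_transformation_def)
  have "f x \<bullet> y = x \<bullet> f y"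
    using isometry[of x "f y"] f(3) by (simp add: pointfree_idE)
  then have "(x + f x) \<bullet> (y + f y) = 2 * (x \<bullet> y + x \<bullet> f y)"
    by (simp add: inner_add_left inner_add_right isometry)
  then have "2 * (\<beta> \<bullet> \<beta>') = x \<bullet> y + x \<bullet> f y"
    by (simp add: \<open>\<beta> = fix_proj f x\<close> \<open>\<beta>' = fix_proj f y\<close> fix_proj_involution[OF f(3)])
  also have "\<dots> \<in> \<int>"
    using integral xy f(2) by (intro Ints_add) auto
  finally show ?thesis .
qed

lemma leech_lattice_integral:
  assumes "is_leech_lattice L" and "x \<in> L" and "y \<in> L"
  shows "x \<bullet> y \<in> \<int>"
proof -
  have "y \<in> {y. \<forall>x\<in>L. \<exists>k::int. x \<bullet> y = of_int k}"
    using assms unfolding is_leech_lattice_def by blast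
  then show ?thesis using assms(2) by (auto simp: Ints_def)
qed

lemma triangle_norms_Ints:
  fixes a b c :: "'a::real_inner"
  assumes "\<And>x y. x \<in> {a, b, c} \<Longrightarrow> y \<in> {a, b, c} \<Longrightarrow> 2 * (x \<bullet> y) \<in> \<int>"
  shows "(a - c) \<bullet> (a - c) + (b - c) \<bullet> (b - c) - (a - b) \<bullet> (a - b) \<in> \<int>"
proof -
  have "(a - c) \<bullet> (a - c) + (b - c) \<bullet> (b - c) - (a - b) \<bullet> (a - b)
        = 2 * (c \<bullet> c) - 2 * (a \<bullet> c) - 2 * (b \<bullet> c) + 2 * (a \<bullet> b)"
    by (simp add: inner_diff_left inner_diff_right inner_commute algebra_simps)
  also have "\<dots> \<in> \<int>"
    using assms by (intro Ints_add Ints_diff) auto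
  finally show ?thesis .
qed

theorem mainTheorem13:
  fixes L :: "(real^24) set" and \<nu> :: "real^24 \<Rightarrow> real^24"
  assumes "is_leech_lattice L"
    and "lattice_aut L \<nu>"
    and "cycle_shape_2_12 \<nu>"
  shows "\<not> (\<exists>h \<in> fix_proj \<nu> ` rat_span L.
             forms_diagram rho_2_12 (diag_vertices L \<nu> rho_2_12 h) \<and>
             contains_A2_cubed rho_2_12 (diag_vertices L \<nu> rho_2_12 h))"
proof
  assume "\<exists>h \<in> fix_proj \<nu> ` rat_span L.
            forms_diagram rho_2_12 (diag_vertices L \<nu> rho_2_12 h) \<and>
            contains_A2_cubed rho_2_12 (diag_vertices L \<nu> rho_2_12 h)"
  then obtain h b where vertices: "\<forall>i<(6::nat). b i \<in> diag_vertices L \<nu> rho_2_12 h"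
    and dist: "\<forall>i<(6::nat). \<forall>j<6. i \<noteq> j \<longrightarrow>
           (b i - b j) \<bullet> (b i - b j) / 2 = (if i div 2 = j div 2 then 3 else 2) * (1 - rho_2_12)"
    unfolding contains_A2_cubed_def by blast
  have aut: "orthogonal_transformation \<nu>" "\<nu> ` L \<subseteq> L"
    using assms(2) by (auto simp: lattice_aut_def)
  have "b i \<in> fix_proj \<nu> ` L" if "i < 6" for i
    using vertices that by (simp add: diag_vertices_def)
  then have "2 * (b i \<bullet> b j) \<in> \<int>" if "i < 6" "j < 6" for i j
    using that two_inner_fix_proj_Ints[OF leech_lattice_integral[OF assms(1)] aut
        cycle_shape_2_12_involution[OF aut(1) assms(3)]] by blast
  then have "(b 0 - b 2) \<bullet> (b 0 - b 2) + (b 1 - b 2) \<bullet> (b 1 - b 2) - (b 0 - b 1) \<bullet> (b 0 - b 1) \<in> \<int>"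
    by (intro triangle_norms_Ints) auto
  moreover have "(b 0 - b 2) \<bullet> (b 0 - b 2) + (b 1 - b 2) \<bullet> (b 1 - b 2) - (b 0 - b 1) \<bullet> (b 0 - b 1) = 1/2"
    using dist[rule_format, of 0 2] dist[rule_format, of 1 2] dist[rule_format, of 0 1]
    by (simp add: rho_2_12_def)
  ultimately have "(1/2 :: real) \<in> \<int>"
    by (simp only:)
  then show False
    using fraction_not_in_Ints[of 2 1] by simp
qed

end
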